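(* Let $n\ge 1$ and, for $0\le k\le n-1$, let $D_k$ be the $n\times n$ diagonal matrix with $D_k(q,q)=e^{i\frac{2\pi kq}{n}}$ for $0\le q\le n-1$. Then for every $n\times n$ complex matrix $A$ there exist circulant $n\times n$ matrices $R_0,R_1,\dots,R_{n-1}$ such that $$A=\sum_{k=0}^{n-1}R_kD_k .$$
   Context: Rows and columns of $n\times n$ matrices are indexed by $0,1,\dots,n-1$. A matrix $R$ is circulant if $R(p,q)$ depends only on $p-q \bmod n$. Here $i$ is the imaginary unit. *)

theory Defs
  imports Complex_Main "Jordan_Normal_Form.Matrix"
begin

text \<open>The differences are taken in the integers, so that they are not truncated.\<close>

definition circulant_mat :: "nat \<Rightarrow> 'a mat \<Rightarrow> bool" where
  "circulant_mat n R \<longleftrightarrow> R \<in> carrier_mat n n \<and>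
     (\<forall>p<n. \<forall>q<n. \<forall>p'<n. \<forall>q'<n.
        (int p - int q) mod int n = (int p' - int q') mod int n \<longrightarrow> R $$ (p, q) = R $$ (p', q'))"

definition D_mat :: "nat \<Rightarrow> nat \<Rightarrow> complex mat" where
  "D_mat n k = mat_diag n (\<lambda>q. exp (\<i> * complex_of_real (2 * pi * real k * real q / real n)))"

end

theory Submission
  imports Defs
begin

text \<open>
  Write \<open>w = exp (2 * pi * i / n)\<close>. Right multiplication by \<open>D\<^sub>k\<close> scales column \<open>q\<close> by
  \<open>w ^ (k * q)\<close>. Now fix a cyclic diagonal of \<open>A\<close>, that is, a residue \<open>p - q\<close> mod \<open>n\<close>: a circulant
  \<open>R\<^sub>k\<close> contributes a single number to it, and the sum of the \<open>R\<^sub>k D\<^sub>k\<close> has on that diagonal the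
  entries \<open>\<Sum>k. R\<^sub>k(p - q) w ^ (k * q)\<close>, indexed by the column \<open>q\<close>. Hence the theorem says that
  each cyclic diagonal of \<open>A\<close>, as a function of the column, is a combination of the \<open>n\<close> characters
  of the integers mod \<open>n\<close>. The coefficients are given by the discrete Fourier transform of the
  diagonal, and orthogonality of the characters (\<open>sum_unity_char\<close>) gives the inversion formula.
\<close>

text \<open>For \<open>q \<noteq> s\<close> the summands are the powers of a root of unity other than 1, so the geometric
  series vanishes.\<close>

lemma sum_unity_char:
  fixes n q s :: nat
  assumes q: "q < n" and s: "s < n"
  shows "(\<Sum>k<n. cis (2 * pi * real k * real q / real n) * cis (- (2 * pi * real k * real s / real n)))
         = (if q = s then of_nat n else 0)"
proof -
  define u where "u t = cis (2 * pi * real t / real n)" for t :: nat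
  have n: "n > 0" using q by simp
  have bij: "bij_betw u {..<n} {z. z ^ n = 1}"
    unfolding u_def by (rule bij_betw_roots_unity[OF n])
  have u1: "u t ^ n = 1" if "t < n" for t
    using bij that by (auto simp: bij_betw_def)
  define z where "z = u q / u s"
  have "cis (2 * pi * real k * real q / real n) * cis (- (2 * pi * real k * real s / real n)) = z ^ k" for k
    unfolding z_def u_def
    by (simp add: cis_divide cis_mult Complex.DeMoivre algebra_simps diff_divide_distrib)
  then have sum: "?thesis \<longleftrightarrow> (\<Sum>k<n. z ^ k) = (if q = s then of_nat n else 0)"
    by simp
  show ?thesis
  proof (cases "q = s")
    case True
    then have "z = 1" by (simp add: z_def u_def)
    then show ?thesis using True sum by simp
  next
    case False
    have "u q \<noteq> u s"
      using bij q s False by (auto simp: bij_betw_def inj_on_def)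
    moreover have "u s \<noteq> 0" by (simp add: u_def)
    ultimately have "z \<noteq> 1" by (simp add: z_def)
    moreover have "z ^ n = 1" by (simp add: z_def power_divide u1 q s)
    ultimately show ?thesis using False sum by (simp add: geometric_sum)
  qed
qed

lemma finsum_mat:
  fixes f :: "'b \<Rightarrow> 'a :: comm_ring_1 mat"
  assumes "finite F" and "f \<in> F \<rightarrow> carrier_mat nr nc"
  shows "finsum (module_mat TYPE('a) nr nc) f F = mat nr nc (\<lambda>(i, j). \<Sum>k\<in>F. f k $$ (i, j))"
proof -
  interpret abelian_group "module_mat TYPE('a) nr nc" by (rule abelian_group_mat)
  show ?thesis
    using assms
  proof (induction F)
    case empty
    then show ?case by (auto simp: module_mat_simps)
  next
    case (insert x F)
    then show ?case
      by (auto simp: finsum_insert module_mat_simps intro!: eq_matI)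
  qed
qed

definition circulant_of_column :: "nat \<Rightarrow> (nat \<Rightarrow> 'a) \<Rightarrow> 'a mat" where
  "circulant_of_column n c = mat n n (\<lambda>(p, q). c (nat ((int p - int q) mod int n)))"

lemma circulant_mat_circulant_of_column: "circulant_mat n (circulant_of_column n c)"
  by (auto simp: circulant_mat_def circulant_of_column_def)

theorem theorem1p4:
  fixes n :: nat and A :: "complex mat"
  assumes "n \<ge> 1" and "A \<in> carrier_mat n n"
  shows "\<exists>R :: nat \<Rightarrow> complex mat. (\<forall>k<n. circulant_mat n (R k)) \<and>
           A = (\<Oplus>\<^bsub>module_mat TYPE(complex) n n\<^esub> k \<in> {0..<n}. R k * D_mat n k)"
proof -
  \<comment> \<open>\<open>a d s\<close> is the entry of \<open>A\<close> in column \<open>s\<close> on the cyclic diagonal \<open>p - q = d\<close>; the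
    \<open>k\<close>-th circulant carries the \<open>k\<close>-th Fourier coefficient of that diagonal.\<close>
  define a where "a d s = A $$ ((d + s) mod n, s)" for d s
  define e where "e k q = cis (2 * pi * real k * real q / real n)" for k q :: nat
  define e' where "e' k s = cis (- (2 * pi * real k * real s / real n))" for k s :: nat
  define R where "R k = circulant_of_column n (\<lambda>d. (\<Sum>s<n. a d s * e' k s) / of_nat n)" for k
  have dim: "R k \<in> carrier_mat n n" for k
    by (simp add: R_def circulant_of_column_def)
  have RD: "R k * D_mat n k = mat n n (\<lambda>(p, q). R k $$ (p, q) * e k q)" for k
    unfolding D_mat_def mat_diag_mult_right[OF dim] e_def cis_conv_exp ..
  have RD_entry: "(R k * D_mat n k) $$ (p, q)
      = (\<Sum>s<n. a (nat ((int p - int q) mod int n)) s / of_nat n * (e k q * e' k s))"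
    if "p < n" "q < n" for k p q
  proof -
    define d where "d = nat ((int p - int q) mod int n)"
    have "(R k * D_mat n k) $$ (p, q) = R k $$ (p, q) * e k q"
      using that by (simp add: RD)
    also have "R k $$ (p, q) = (\<Sum>s<n. a d s * e' k s) / of_nat n"
      using that by (simp add: R_def circulant_of_column_def d_def)
    also have "\<dots> * e k q = (\<Sum>s<n. a d s / of_nat n * (e k q * e' k s))"
      unfolding sum_divide_distrib sum_distrib_right by (simp add: mult_ac)
    finally show ?thesis unfolding d_def .
  qed
  have "A = mat n n (\<lambda>(p, q). \<Sum>k\<in>{0..<n}. (R k * D_mat n k) $$ (p, q))"
  proof (rule eq_matI)
    fix p q
    assume "p < dim_row (mat n n (\<lambda>(p, q). \<Sum>k\<in>{0..<n}. (R k * D_mat n k) $$ (p, q)))"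
      and "q < dim_col (mat n n (\<lambda>(p, q). \<Sum>k\<in>{0..<n}. (R k * D_mat n k) $$ (p, q)))"
    then have p: "p < n" and q: "q < n" by auto
    define d where "d = nat ((int p - int q) mod int n)"
    have "int ((d + q) mod n) = ((int p - int q) mod int n + int q) mod int n"
      using assms(1) by (simp add: d_def zmod_int)
    also have "\<dots> = int p" using p by (simp add: mod_add_left_eq)
    finally have d: "(d + q) mod n = p" by simp
    have "(\<Sum>k\<in>{0..<n}. (R k * D_mat n k) $$ (p, q))
        = (\<Sum>k<n. \<Sum>s<n. a d s / of_nat n * (e k q * e' k s))"
      using p q
      by (simp only: RD_entry d_def atLeast0LessThan)
    also have "\<dots> = (\<Sum>s<n. a d s / of_nat n * (\<Sum>k<n. e k q * e' k s))"
      by (subst sum.swap) (simp add: sum_distrib_left)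
    also have "\<dots> = (\<Sum>s<n. if q = s then a d s else 0)"
      using q assms(1)
      by (intro sum.cong refl) (simp add: e_def e'_def sum_unity_char)
    also have "\<dots> = A $$ (p, q)"
      using q by (simp add: a_def d)
    finally show "A $$ (p, q) = mat n n (\<lambda>(p, q). \<Sum>k\<in>{0..<n}. (R k * D_mat n k) $$ (p, q)) $$ (p, q)"
      using p q by simp
  qed (use assms(2) in auto)
  also have "\<dots> = (\<Oplus>\<^bsub>module_mat TYPE(complex) n n\<^esub> k \<in> {0..<n}. R k * D_mat n k)"
    by (rule finsum_mat[symmetric]) (auto simp: RD)
  finally show ?thesis
    by (intro exI[of _ R]) (simp add: R_def circulant_mat_circulant_of_column)
qed

end
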